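(* For every $r\in[2,\infty)$ there are a minimal subshift $(X_r,\sigma)$ over a finite alphabet, constants $C_r,c_r>0$, and an increasing sequence $(n_i^{(r)})$ of (positive) integers such that: (i) for all $n\geq 2$, $R_{X_r}(n)\leq\exp\big(C_r(\log n)^r\big)$; (ii) for all $i\in\mathbb{N}$, $p_{X_r}(n_i^{(r)})\geq\exp\big(c_r(\log n_i^{(r)})^r\big)$.
   Context: Let $A$ be a finite discrete set with $|A|\geq 2$ (the alphabet), give $A^{\mathbb{Z}}$ the product topology, and let $\sigma$ be the shift homeomorphism $\sigma(\mathbf{a})_i=a_{i+1}$. An $n$-factor of a (finite or bi-infinite) word $w$ is a word $w_kw_{k+1}\cdots w_{k+n-1}\in A^n$ of consecutive letters of $w$; $F_n(w)$ is the set of $n$-factors of $w$. The complexity function is $p_{\mathbf{x}}(n)=|F_n(\mathbf{x})|$. A word $\mathbf{x}\in A^{\mathbb{Z}}$ is uniformly recurrent if for every $n\in\mathbb{N}$ there is $M_n\in\mathbb{N}$ such that $w\in F_n(v)$ for every $w\in F_n(\mathbf{x})$ and every $v\in F_{M_n}(\mathbf{x})$; the smallest such $M_n$ is denoted $R_{\mathbf{x}}(n)$ and $R_{\mathbf{x}}$ is the recurrence function. It is non-periodic if $\sigma^p\mathbf{x}\neq\mathbf{x}$ for all $p\geq 1$. A minimal subshift is $X=\overline{\{\sigma^i\mathbf{x}:i\in\mathbb{Z}\}}\subseteq A^{\mathbb{Z}}$ with $\mathbf{x}$ uniformly recurrent and non-periodic; $F_n(\mathbf{y})=F_n(\mathbf{x})$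 for all $\mathbf{y}\in X$, so $R_X:=R_{\mathbf{x}}$ and $p_X:=p_{\mathbf{x}}$ depend only on $X$. *)

theory Defs
  imports "HOL-Analysis.Analysis"
begin

definition full_shift :: "'a set \<Rightarrow> (int \<Rightarrow> 'a) topology" where
  "full_shift A = product_topology (\<lambda>_. discrete_topology A) UNIV"

definition left_shift :: "(int \<Rightarrow> 'a) \<Rightarrow> int \<Rightarrow> 'a" where
  "left_shift x = (\<lambda>i. x (i + 1))"

text \<open>Integer powers of the shift in closed form; the two lemmas below identify
  them with the iterates of \<^const>\<open>left_shift\<close> and their inverses.\<close>

definition shift_pow :: "int \<Rightarrow> (int \<Rightarrow> 'a) \<Rightarrow> int \<Rightarrow> 'a" where
  "shift_pow k x = (\<lambda>i. x (i + k))"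

lemma shift_pow_of_nat: "shift_pow (int n) = left_shift ^^ n"
proof (induction n)
  case 0
  show ?case by (simp add: shift_pow_def fun_eq_iff)
next
  case (Suc n)
  have "shift_pow (int (Suc n)) x = (left_shift ^^ Suc n) x" for x :: "int \<Rightarrow> 'a"
  proof -
    have "(left_shift ^^ Suc n) x = left_shift (shift_pow (int n) x)"
      unfolding Suc.IH by (simp only: funpow.simps o_apply)
    also have "\<dots> = shift_pow (int (Suc n)) x"
      by (simp add: shift_pow_def left_shift_def add_ac)
    finally show ?thesis by (rule sym)
  qed
  then show ?case by (rule ext)
qed

lemma shift_pow_uminus: "shift_pow k (shift_pow (- k) x) = x"
  by (simp add: shift_pow_def)

text \<open>Finite words are lists. The words of length \<open>n\<close> occurring in a
  bi-infinite, respectively in a finite, word:\<close>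

definition factors :: "nat \<Rightarrow> (int \<Rightarrow> 'a) \<Rightarrow> 'a list set" where
  "factors n x = {map (\<lambda>j. x (k + int j)) [0..<n] | k. True}"

definition list_factors :: "nat \<Rightarrow> 'a list \<Rightarrow> 'a list set" where
  "list_factors n v = {take n (drop k v) | k. k + n \<le> length v}"

definition complexity :: "(int \<Rightarrow> 'a) \<Rightarrow> nat \<Rightarrow> nat" where
  "complexity x n = card (factors n x)"

definition recurrence_bound :: "(int \<Rightarrow> 'a) \<Rightarrow> nat \<Rightarrow> nat \<Rightarrow> bool" where
  "recurrence_bound x n M \<longleftrightarrow> (\<forall>w \<in> factors n x. \<forall>v \<in> factors M x. w \<in> list_factors n v)"

definition uniformly_recurrent :: "(int \<Rightarrow> 'a) \<Rightarrow> bool" where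
  "uniformly_recurrent x \<longleftrightarrow> (\<forall>n. \<exists>M. recurrence_bound x n M)"

definition recurrence :: "(int \<Rightarrow> 'a) \<Rightarrow> nat \<Rightarrow> nat" where
  "recurrence x n = (LEAST M. recurrence_bound x n M)"

definition non_periodic :: "(int \<Rightarrow> 'a) \<Rightarrow> bool" where
  "non_periodic x \<longleftrightarrow> (\<forall>p\<ge>1. (left_shift ^^ p) x \<noteq> x)"

definition minimal_subshift :: "'a set \<Rightarrow> (int \<Rightarrow> 'a) set \<Rightarrow> bool" where
  "minimal_subshift A X \<longleftrightarrow> finite A \<and> card A \<ge> 2 \<and>
     (\<exists>x \<in> topspace (full_shift A). uniformly_recurrent x \<and> non_periodic x \<and>
        X = full_shift A closure_of range (\<lambda>i. shift_pow i x))"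

text \<open>The common value of \<^const>\<open>recurrence\<close>, respectively \<^const>\<open>complexity\<close>,
  on the points of a minimal subshift; it exists by the lemmas
  \<open>minimal_subshift_recurrence\<close> and \<open>minimal_subshift_complexity\<close> below.\<close>

definition subshift_recurrence :: "(int \<Rightarrow> 'a) set \<Rightarrow> nat \<Rightarrow> nat" where
  "subshift_recurrence X n = (THE m. \<forall>x\<in>X. recurrence x n = m)"

definition subshift_complexity :: "(int \<Rightarrow> 'a) set \<Rightarrow> nat \<Rightarrow> nat" where
  "subshift_complexity X n = (THE m. \<forall>x\<in>X. complexity x n = m)"

lemma factors_orbit_closure_subset:
  assumes y: "y \<in> full_shift A closure_of range (\<lambda>i. shift_pow i x)"
  shows "factors n y \<subseteq> factors n x"
proof
  fix w assume "w \<in> factors n y"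
  then obtain k where w: "w = map (\<lambda>j. y (k + int j)) [0..<n]"
    unfolding factors_def by blast
  have yA: "y \<in> UNIV \<rightarrow>\<^sub>E A"
    using y by (simp add: in_closure_of full_shift_def)
  define T where "T = (\<Pi>\<^sub>E i\<in>UNIV. if i \<in> {k..<k + int n} then {y i} else A)"
  have "openin (full_shift A) T"
    unfolding full_shift_def T_def
  proof (rule product_topology_basis)
    show "openin (discrete_topology A) (if i \<in> {k..<k + int n} then {y i} else A)" for i
      using yA by (auto simp: PiE_def)
    show "finite {i. (if i \<in> {k..<k + int n} then {y i} else A) \<noteq> topspace (discrete_topology A)}"
      by (rule finite_subset[of _ "{k..<k + int n}"]) auto
  qed
  moreover have "y \<in> T" using yA by (auto simp: T_def)
  ultimately obtain z where z: "z \<in> range (\<lambda>i. shift_pow i x)" "z \<in> T"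
    using y unfolding in_closure_of by blast
  then obtain i where i: "z = shift_pow i x" by blast
  have "z (k + int j) = y (k + int j)" if "j < n" for j
    using PiE_mem[OF z(2)[unfolded T_def], of "k + int j"] that by auto
  then have "w = map (\<lambda>j. x ((k + i) + int j)) [0..<n]"
    unfolding w i by (simp add: shift_pow_def algebra_simps)
  then show "w \<in> factors n x" unfolding factors_def by blast
qed

lemma list_factors_of_factor:
  assumes "w \<in> list_factors n v" "v \<in> factors M y"
  shows "w \<in> factors n y"
proof -
  from assms obtain k l where v: "v = map (\<lambda>j. y (k + int j)) [0..<M]"
    and w: "w = take n (drop l v)" and l: "l + n \<le> length v"
    unfolding factors_def list_factors_def by blast
  have "w = map (\<lambda>j. y ((k + int l) + int j)) [0..<n]"
    using l by (intro nth_equalityI) (auto simp: w v algebra_simps)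
  then show ?thesis unfolding factors_def by blast
qed

lemma factors_orbit_closure:
  assumes "uniformly_recurrent x" "y \<in> full_shift A closure_of range (\<lambda>i. shift_pow i x)"
  shows "factors n y = factors n x"
proof
  show "factors n y \<subseteq> factors n x" by (rule factors_orbit_closure_subset[OF assms(2)])
  obtain M where M: "recurrence_bound x n M"
    using assms(1) unfolding uniformly_recurrent_def by blast
  define v where "v = map (\<lambda>j. y (0 + int j)) [0..<M]"
  have vy: "v \<in> factors M y" unfolding factors_def v_def by blast
  then have "v \<in> factors M x" using factors_orbit_closure_subset[OF assms(2)] by blast
  then show "factors n x \<subseteq> factors n y"
    using M vy unfolding recurrence_bound_def by (blast intro: list_factors_of_factor)
qed

lemma minimal_subshift_factors:
  assumes "minimal_subshift A X" "x \<in> X" "y \<in> X"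
  shows "factors n x = factors n y"
proof -
  obtain z where "uniformly_recurrent z" "X = full_shift A closure_of range (\<lambda>i. shift_pow i z)"
    using assms(1) unfolding minimal_subshift_def by blast
  then show ?thesis using assms(2,3) by (simp add: factors_orbit_closure[of z])
qed

lemma minimal_subshift_complexity:
  assumes "minimal_subshift A X" "x \<in> X"
  shows "subshift_complexity X n = complexity x n"
proof -
  have "complexity y n = complexity x n" if "y \<in> X" for y
    unfolding complexity_def by (rule arg_cong[OF minimal_subshift_factors[OF assms(1) that assms(2)]])
  then show ?thesis
    unfolding subshift_complexity_def using assms(2) by (intro the_equality) (blast, metis)
qed

lemma minimal_subshift_recurrence:
  assumes "minimal_subshift A X" "x \<in> X"
  shows "subshift_recurrence X n = recurrence x n"
proof -
  have "recurrence y n = recurrence x n" if "y \<in> X" for y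
    unfolding recurrence_def recurrence_bound_def minimal_subshift_factors[OF assms(1) that assms(2)]
    by (rule refl)
  then show ?thesis
    unfolding subshift_recurrence_def using assms(2) by (intro the_equality) (blast, metis)
qed

end

theory Submission imports Defs begin

text \<open>The word is built from blocks of lengths \<open>L 0 < L 1 < \<dots>\<close>: there are \<open>N k\<close> blocks of
  length \<open>L k\<close>, and each block of level \<open>k + 1\<close> is a concatenation of blocks of level \<open>k\<close>
  in which every ordered pair of these occurs. A factor of length at most \<open>L k\<close> meets at most two
  consecutive blocks of level \<open>k\<close>, so it reappears in every block of level \<open>k + 1\<close>,
  that is \<open>R n \<le> 2 * L (k + 1)\<close>; and the complexity at \<open>L k\<close> is at least \<open>N k\<close>.
  The two requirements are reconciled by letting \<open>N\<close> alternate. From two blocks of length \<open>l\<close>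
  one forms \<open>2 ^ w\<close> blocks with \<open>w\<close> close to \<open>(ln l) powr r\<close>; their length
  \<open>(w + 9) * l\<close> is still polynomial in \<open>l\<close>. From these one forms two blocks again, long
  enough to contain all \<open>4 ^ w\<close> pairs.\<close>

section \<open>Preliminaries: base-\<open>N\<close> digits, and the complexity of periodic
  words\<close>

lemma digits_inj:
  fixes a b N :: nat
  assumes "a < N ^ m" "b < N ^ m" "\<And>i. i < m \<Longrightarrow> a div N ^ i mod N = b div N ^ i mod N"
  shows "a = b"
  using assms
proof (induction m arbitrary: a b)
  case 0
  then show ?case by simp
next
  case (Suc m)
  have "a div N = b div N"
  proof (rule Suc.IH)
    show "a div N < N ^ m" "b div N < N ^ m"
      using Suc.prems(1,2) by (auto simp: less_mult_imp_div_less mult.commute)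
    show "a div N div N ^ i mod N = b div N div N ^ i mod N" if "i < m" for i
      using Suc.prems(3)[of "Suc i"] that by (simp add: div_mult2_eq)
  qed
  moreover have "a mod N = b mod N" using Suc.prems(3)[of 0] by simp
  ultimately show ?case by (metis div_mult_mod_eq)
qed

text \<open>A window is determined by its starting position modulo \<open>p\<close>.\<close>

lemma complexity_le_period:
  assumes "(left_shift ^^ p) x = x" "p \<ge> 1"
  shows "complexity x n \<le> p"
proof -
  have step: "x (i + int p) = x i" for i
    using assms(1) by (simp add: shift_pow_of_nat[symmetric] shift_pow_def fun_eq_iff)
  have mult: "x (i + int p * int t) = x i" for i t
  proof (induction t)
    case (Suc t)
    then show ?case using step[of "i + int p * int t"] by (simp add: algebra_simps)
  qed simp
  have per: "x i = x (i + int p * t)" for i t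
  proof (cases "t \<ge> 0")
    case True
    then show ?thesis using mult[of i "nat t"] by simp
  next
    case False
    then show ?thesis using mult[of "i + int p * t" "nat (- t)"] by simp
  qed
  have "factors n x \<subseteq> (\<lambda>k. map (\<lambda>j. x (int k + int j)) [0..<n]) ` {..<p}"
  proof
    fix w assume "w \<in> factors n x"
    then obtain k where w: "w = map (\<lambda>j. x (k + int j)) [0..<n]" unfolding factors_def by blast
    have "x (k + int j) = x (int (nat (k mod int p)) + int j)" for j
    proof -
      have "k mod int p = k + int p * - (k div int p)"
        by (simp add: minus_mult_div_eq_mod[symmetric])
      moreover have "0 \<le> k mod int p" using assms(2) by simp
      ultimately have "int (nat (k mod int p)) + int j = k + int j + int p * - (k div int p)"
        by linarith
      then show ?thesis using per[of "k + int j" "- (k div int p)"] by (simp only:)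
    qed
    moreover have "nat (k mod int p) < p" using assms(2) by (simp add: nat_less_iff)
    ultimately show "w \<in> (\<lambda>k. map (\<lambda>j. x (int k + int j)) [0..<n]) ` {..<p}"
      unfolding w by (intro image_eqI[of _ _ "nat (k mod int p)"]) auto
  qed
  from card_mono[OF _ this] have "complexity x n \<le> card ((\<lambda>k. map (\<lambda>j. x (int k + int j)) [0..<n]) ` {..<p})"
    unfolding complexity_def by simp
  also have "\<dots> \<le> card {..<p}" by (rule card_image_le) simp
  finally show ?thesis by simp
qed

section \<open>Words with prescribed substitutive structure\<close>

text \<open>Level \<open>k\<close> has \<open>N k\<close> letters, and \<open>\<tau> k a\<close>
  spells a letter \<open>a\<close> of level \<open>k + 1\<close> in \<open>M k\<close> letters of
  level \<open>k\<close>. \<open>sub_first\<close> and \<open>sub_last\<close> allow the letter 0 on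
  both sides of the origin on all levels; \<open>sub_pairs\<close> yields recurrence,
  \<open>sub_inj\<close> complexity.\<close>

locale substitution_sequence =
  fixes N M :: "nat \<Rightarrow> nat" and \<tau> :: "nat \<Rightarrow> nat \<Rightarrow> nat \<Rightarrow> nat"
  assumes M_ge_2: "2 \<le> M k"
    and N_pos: "0 < N k"
    and sub_less: "a < N (Suc k) \<Longrightarrow> j < M k \<Longrightarrow> \<tau> k a j < N k"
    and sub_first: "\<tau> k 0 0 = 0"
    and sub_last: "\<tau> k 0 (M k - 1) = 0"
    and sub_pairs: "\<lbrakk>a < N (Suc k); b < N k; b' < N k\<rbrakk> \<Longrightarrow>
          \<exists>j. Suc j < M k \<and> \<tau> k a j = b \<and> \<tau> k a (Suc j) = b'"
    and sub_inj: "\<lbrakk>a < N (Suc k); b < N (Suc k); \<And>j. j < M k \<Longrightarrow> \<tau> k a j = \<tau> k b j\<rbrakk> \<Longrightarrow> a = b"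
begin

definition L :: "nat \<Rightarrow> nat" where
  "L k = (\<Prod>i<k. M i)"

primrec block :: "nat \<Rightarrow> nat \<Rightarrow> nat \<Rightarrow> nat" where
  "block 0 a s = a"
| "block (Suc k) a s = block k (\<tau> k a (s div L k)) (s mod L k)"

text \<open>\<open>letter k q\<close> is the letter whose level-\<open>k\<close> block occupies positions
  \<open>q * L k, \<dots>, (q + 1) * L k - 1\<close>. The blocks adjacent to the origin carry the letter 0
  on every level, which is consistent because the image of 0 starts and ends with 0.\<close>

function letter :: "nat \<Rightarrow> int \<Rightarrow> nat" where
  "letter k q = (if q = 0 \<or> q = -1 then 0
     else \<tau> k (letter (Suc k) (q div int (M k))) (nat (q mod int (M k))))"
  by pat_completeness auto
termination
\<comment> \<open>As \<open>M k\<close> is at least 2, floor division strictly decreases the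
  absolute value of \<open>q\<close>, except at its fixed points 0 and -1.\<close>
proof (relation "Wellfounded.measure (\<lambda>(k, q). nat \<bar>q\<bar>)")
  fix k :: nat and q :: int
  assume q: "\<not> (q = 0 \<or> q = -1)"
  have M: "2 \<le> int (M k)" using M_ge_2[of k] by simp
  define d m where "d = q div int (M k)" and "m = q mod int (M k)"
  have qe: "q = int (M k) * d + m" unfolding d_def m_def by simp
  have m: "0 \<le> m" "m < int (M k)" using M unfolding m_def by auto
  have "\<bar>d\<bar> < \<bar>q\<bar>"
  proof (cases "d \<ge> 0")
    case True
    have "2 * d \<le> int (M k) * d" using M True by (intro mult_right_mono)
    then show ?thesis using qe m q True by linarith
  next
    case False
    \<comment> \<open>This trades the nonlinear \<open>M k * d\<close> for a bound linear in
      \<open>d\<close>; the borderline case \<open>d = -1\<close> is saved by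
      \<open>q \<noteq> -1\<close>.\<close>
    have "(int (M k) - 2) * (d + 1) \<le> 0" using M False by (intro mult_nonneg_nonpos) auto
    then have "int (M k) * d \<le> 2 * d + 2 - int (M k)" by (simp add: algebra_simps)
    then have "q < 2 * d + 2" using qe m by linarith
    then show ?thesis using q False by linarith
  qed
  then show "((Suc k, q div int (M k)), k, q) \<in> Wellfounded.measure (\<lambda>(k, q). nat \<bar>q\<bar>)"
    unfolding d_def by simp
qed simp

declare letter.simps [simp del]

definition word :: "int \<Rightarrow> nat" where "word = letter 0"

section \<open>The word as a concatenation of blocks on every level\<close>

lemma L_0 [simp]: "L 0 = 1"
  by (simp add: L_def)

lemma L_Suc: "L (Suc k) = M k * L k"
  by (simp add: L_def)

lemma L_pos: "0 < L k"
  unfolding L_def using M_ge_2 by (intro prod_pos) (meson less_le_trans zero_less_numeral)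

lemma L_less_Suc: "L k < L (Suc k)"
proof -
  have "2 * L k \<le> L (Suc k)" unfolding L_Suc using M_ge_2 by (rule mult_right_mono) simp
  then show ?thesis using L_pos[of k] by linarith
qed

lemma strict_mono_L: "strict_mono L"
  by (rule strict_mono_Suc_iff[THEN iffD2]) (simp add: L_less_Suc)

text \<open>The recursion holds without its exceptional cases: 0 is the first letter of its own
  image, and -1 has quotient -1 and remainder \<open>M k - 1\<close>, the last position.\<close>

lemma letter_step:
  "letter k q = \<tau> k (letter (Suc k) (q div int (M k))) (nat (q mod int (M k)))"
proof -
  have M: "2 \<le> int (M k)" using M_ge_2[of k] by simp
  consider "q = 0" | "q = -1" | "q \<noteq> 0" "q \<noteq> -1" by blast
  then show ?thesis
  proof cases
    case 2
    have d: "(-1) div int (M k) = -1" and m: "(-1) mod int (M k) = int (M k) - 1"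
      using M by (auto simp: div_eq_minus1 zmod_minus1)
    have "nat (int (M k) - 1) = M k - 1" by simp
    then show ?thesis unfolding 2 d m using sub_last[of k] by (simp add: letter.simps)
  qed (simp_all add: letter.simps sub_first)
qed

lemma letter_less: "letter k q < N k"
proof (induction k q rule: letter.induct)
  case (1 k q)
  have "nat (q mod int (M k)) < M k"
    using M_ge_2[of k] by (simp add: nat_less_iff)
  then show ?case using 1 N_pos[of k] by (subst letter.simps) (auto intro: sub_less)
qed

lemma letter_mult_add:
  assumes "j < M k"
  shows "letter k (Q * int (M k) + int j) = \<tau> k (letter (Suc k) Q) j"
  by (subst letter_step) (use assms in simp)

lemma word_mult_add:
  assumes "s < L k"
  shows "word (q * int (L k) + int s) = block k (letter k q) s"
  using assms
proof (induction k arbitrary: q s)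
  case 0
  then show ?case by (simp add: word_def)
next
  case (Suc k)
  define j t where "j = s div L k" and "t = s mod L k"
  have s: "s = j * L k + t" unfolding j_def t_def by (rule div_mult_mod_eq[symmetric])
  have j: "j < M k" using Suc.prems by (simp add: j_def L_Suc less_mult_imp_div_less)
  have t: "t < L k" using L_pos by (simp add: t_def)
  have "q * int (L (Suc k)) + int s = (q * int (M k) + int j) * int (L k) + int t"
    by (simp add: L_Suc s algebra_simps)
  then have "word (q * int (L (Suc k)) + int s) = block k (letter k (q * int (M k) + int j)) t"
    using Suc.IH[OF t] by simp
  then show ?case using letter_mult_add[OF j] by (simp add: j_def t_def)
qed

text \<open>Equal blocks have equal sub-blocks, hence by induction equal spellings, and
  \<open>sub_inj\<close> applies.\<close>

lemma block_inj:
  assumes "a < N k" "b < N k" "\<And>s. s < L k \<Longrightarrow> block k a s = block k b s"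
  shows "a = b"
  using assms
proof (induction k arbitrary: a b)
  case 0
  then show ?case by simp
next
  case (Suc k)
  show ?case
  proof (rule sub_inj[OF Suc.prems(1,2)])
    fix j assume j: "j < M k"
    show "\<tau> k a j = \<tau> k b j"
    proof (rule Suc.IH)
      fix s assume s: "s < L k"
      have "j * L k + s < Suc j * L k" using s by simp
      also have "\<dots> \<le> M k * L k" using j by (intro mult_right_mono) auto
      finally have "j * L k + s < L (Suc k)" by (simp add: L_Suc)
      from Suc.prems(3)[OF this] show "block k (\<tau> k a j) s = block k (\<tau> k b j) s"
        using s by simp
    qed (use j Suc.prems sub_less in auto)
  qed
qed

section \<open>Recurrence of the word\<close>

lemma letter_pair_in_block:
  obtains j where "Suc j < M k"
    "letter k (Q * int (M k) + int j) = letter k q"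
    "letter k (Q * int (M k) + int j + 1) = letter k (q + 1)"
proof -
  obtain j where j: "Suc j < M k" "\<tau> k (letter (Suc k) Q) j = letter k q"
    "\<tau> k (letter (Suc k) Q) (Suc j) = letter k (q + 1)"
    using sub_pairs letter_less by blast
  show ?thesis
    using that[OF j(1)] letter_mult_add[of j k Q] letter_mult_add[of "Suc j" k Q] j
    by (simp add: add_ac)
qed

text \<open>A factor of length at most \<open>L k\<close> that starts in block \<open>q\<close> ends
  by block \<open>q + 1\<close>, so matching these two letters suffices to copy it.\<close>

lemma word_pair:
  assumes "letter k q = letter k q'" "letter k (q + 1) = letter k (q' + 1)" "t < 2 * L k"
  shows "word (q * int (L k) + int t) = word (q' * int (L k) + int t)"
proof (cases "t < L k")
  case True
  then show ?thesis using assms(1) by (simp add: word_mult_add)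
next
  case False
  then have "q * int (L k) + int t = (q + 1) * int (L k) + int (t - L k)" for q
    by (simp add: algebra_simps)
  moreover have "t - L k < L k" using False assms(3) by linarith
  ultimately show ?thesis using assms(2) by (simp add: word_mult_add)
qed

text \<open>A window of length \<open>2 * L (Suc k)\<close> contains a whole block of level
  \<open>k + 1\<close>, which contains the two level-\<open>k\<close> blocks covering the given
  factor.\<close>

lemma recurrence_bound_word:
  assumes n: "n \<le> L k"
  shows "recurrence_bound word n (2 * L (Suc k))"
  unfolding recurrence_bound_def
proof (intro ballI)
  fix w v assume "w \<in> factors n word" "v \<in> factors (2 * L (Suc k)) word"
  then obtain p P where w: "w = map (\<lambda>j. word (p + int j)) [0..<n]"
    and v: "v = map (\<lambda>j. word (P + int j)) [0..<2 * L (Suc k)]"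
    unfolding factors_def by blast
  define q s where "q = p div int (L k)" and "s = nat (p mod int (L k))"
  have p: "p = q * int (L k) + int s" and s: "s < L k"
    using L_pos[of k] by (auto simp: q_def s_def nat_less_iff)
  \<comment> \<open>\<open>Q\<close> is the first block that starts strictly after \<open>P\<close>,
    at distance \<open>d\<close>. If \<open>P\<close> is itself a boundary, then
    \<open>d = L (Suc k)\<close>, which still fits.\<close>
  define Q where "Q = P div int (L (Suc k)) + 1"
  define d where "d = nat (int (L (Suc k)) - P mod int (L (Suc k)))"
  have Pmod: "0 \<le> P mod int (L (Suc k))" "P mod int (L (Suc k)) < int (L (Suc k))"
    using L_pos[of "Suc k"] by auto
  have d: "d \<le> L (Suc k)" "P + int d = Q * int (L (Suc k))"
    using Pmod div_mult_mod_eq[of P "int (L (Suc k))"]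
    by (auto simp: d_def Q_def algebra_simps)
  obtain j where j: "Suc j < M k"
    "letter k (Q * int (M k) + int j) = letter k q"
    "letter k (Q * int (M k) + int j + 1) = letter k (q + 1)"
    by (rule letter_pair_in_block)
  define l where "l = d + j * L k + s"
  have "(j + 2) * L k \<le> M k * L k" using j(1) by (intro mult_right_mono) auto
  then have len: "l + n \<le> 2 * L (Suc k)"
    using d(1) s n by (simp add: l_def L_Suc)
  have "word (p + int i) = word (P + int (l + i))" if "i < n" for i
  proof -
    have "word (q * int (L k) + int (s + i)) = word ((Q * int (M k) + int j) * int (L k) + int (s + i))"
      using j s n that by (intro word_pair) auto
    moreover have "P + int (l + i) = (Q * int (M k) + int j) * int (L k) + int (s + i)"
      using d(2) by (simp add: l_def L_Suc algebra_simps)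
    moreover have "p + int i = q * int (L k) + int (s + i)" by (simp add: p)
    ultimately show ?thesis by (simp only:)
  qed
  then have "w = take n (drop l v)"
    using len by (intro nth_equalityI) (auto simp: w v)
  then show "w \<in> list_factors n v"
    unfolding list_factors_def using len by (auto simp: v)
qed

lemma uniformly_recurrent_word: "uniformly_recurrent word"
  unfolding uniformly_recurrent_def
  by (intro allI exI, rule recurrence_bound_word, rule strict_mono_imp_increasing[OF strict_mono_L])

lemma recurrence_word_le: "n \<le> L k \<Longrightarrow> recurrence word n \<le> 2 * L (Suc k)"
  unfolding recurrence_def by (intro Least_le recurrence_bound_word)

section \<open>Complexity of the word and the subshift it generates\<close>

lemma letter_surj:
  assumes "a < N k"
  obtains q where "letter k q = a"
proof -
  obtain j where "Suc j < M k" "\<tau> k (letter (Suc k) 0) j = a"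
    using sub_pairs[OF letter_less assms assms] by blast
  then show ?thesis using that[of "int j"] letter_mult_add[of j k 0] by simp
qed

lemma finite_factors_word: "finite (factors n word)"
proof (rule finite_subset)
  show "factors n word \<subseteq> {xs. set xs \<subseteq> {..<N 0} \<and> length xs = n}"
    using letter_less[of 0] by (auto simp: factors_def word_def)
qed (simp add: finite_lists_length_eq)

text \<open>All \<open>N k\<close> blocks occur in the word, and they are distinct by
  \<open>block_inj\<close>.\<close>

lemma complexity_word_ge: "N k \<le> complexity word (L k)"
proof -
  define B where "B a = map (block k a) [0..<L k]" for a
  have "inj_on B {..<N k}"
    by (rule inj_onI, rule block_inj[of _ k]) (auto simp: B_def)
  moreover have "B ` {..<N k} \<subseteq> factors (L k) word"
  proof
    fix w assume "w \<in> B ` {..<N k}"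
    then obtain a where a: "a < N k" "w = B a" by blast
    obtain q where "letter k q = a" using a(1) by (rule letter_surj)
    then have "w = map (\<lambda>j. word (q * int (L k) + int j)) [0..<L k]"
      by (auto simp: a(2) B_def word_mult_add)
    then show "w \<in> factors (L k) word" unfolding factors_def by blast
  qed
  ultimately have "card {..<N k} \<le> complexity word (L k)"
    unfolding complexity_def using finite_factors_word by (rule card_inj_on_le)
  then show ?thesis by simp
qed

text \<open>A period \<open>p\<close> would bound the complexity, and with it every
  \<open>N k\<close>, by \<open>p\<close>.\<close>

lemma non_periodic_word:
  assumes "\<And>p. \<exists>k. p < N k"
  shows "non_periodic word"
  unfolding non_periodic_def
proof (intro allI impI notI)
  fix p :: nat assume "1 \<le> p" "(left_shift ^^ p) word = word"
  then have "N k \<le> p" for k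
    using complexity_le_period[of p word "L k"] complexity_word_ge[of k] by linarith
  then show False using assms[of p] by (meson not_le)
qed

lemma minimal_subshift_word:
  assumes "N 0 \<ge> 2" "\<And>p. \<exists>k. p < N k"
  defines "X \<equiv> full_shift {..<N 0} closure_of range (\<lambda>i. shift_pow i word)"
  shows "minimal_subshift {..<N 0} X" "word \<in> X"
proof -
  have less: "word i < N 0" for i using letter_less[of 0 i] by (simp add: word_def)
  then have top: "word \<in> topspace (full_shift {..<N 0})"
    by (auto simp: full_shift_def)
  show "minimal_subshift {..<N 0} X"
    unfolding minimal_subshift_def X_def
    using assms(1) top uniformly_recurrent_word non_periodic_word[OF assms(2)] by auto
  have "range (\<lambda>i. shift_pow i word) \<subseteq> topspace (full_shift {..<N 0})"
    using less by (auto simp: full_shift_def shift_pow_def)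
  moreover have "word \<in> range (\<lambda>i. shift_pow i word)"
    by (rule range_eqI[of _ _ 0]) (simp add: shift_pow_def)
  ultimately show "word \<in> X"
    unfolding X_def by (rule subsetD[OF closure_of_subset])
qed

end

section \<open>A substitution containing all pairs of letters\<close>

text \<open>The listing of all pairs over \<open>{..<N}\<close>, then the \<open>e\<close> base-\<open>N\<close> digits of the letter
  \<open>a\<close>, which make the substitution injective, then a final 0.\<close>

definition pair_sub :: "nat \<Rightarrow> nat \<Rightarrow> nat \<Rightarrow> nat \<Rightarrow> nat" where
  "pair_sub N e a j =
     (if j < 2 * N\<^sup>2 then (if even j then j div 2 div N else j div 2 mod N)
      else if j < 2 * N\<^sup>2 + e then a div N ^ (j - 2 * N\<^sup>2) mod N else 0)"

lemma pair_sub_less: "0 < N \<Longrightarrow> pair_sub N e a j < N"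
  by (auto simp: pair_sub_def power2_eq_square intro!: less_mult_imp_div_less)

lemma pair_sub_pairs:
  assumes "b < N" "b' < N"
  shows "\<exists>j. Suc j < 2 * N\<^sup>2 + e + 1 \<and> pair_sub N e a j = b \<and> pair_sub N e a (Suc j) = b'"
proof -
  \<comment> \<open>The pair \<open>(b, b')\<close>, read as a two-digit number in base
    \<open>N\<close>, is its index in the listing.\<close>
  define t where "t = b * N + b'"
  have "t < Suc b * N" using assms(2) by (simp add: t_def)
  also have "\<dots> \<le> N * N" using assms(1) by (intro mult_right_mono) auto
  finally have t: "t < N\<^sup>2" by (simp add: power2_eq_square)
  have "t div N = b" "t mod N = b'" using assms(2) by (auto simp: t_def)
  moreover have "2 * t < 2 * N\<^sup>2" "Suc (2 * t) < 2 * N\<^sup>2" using t by linarith+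
  ultimately have "pair_sub N e a (2 * t) = b" "pair_sub N e a (Suc (2 * t)) = b'"
    by (simp_all add: pair_sub_def)
  moreover have "Suc (2 * t) < 2 * N\<^sup>2 + e + 1" using t by linarith
  ultimately show ?thesis by blast
qed

lemma pair_sub_inj:
  assumes "a < N ^ e" "b < N ^ e"
    "\<And>j. j < 2 * N\<^sup>2 + e + 1 \<Longrightarrow> pair_sub N e a j = pair_sub N e b j"
  shows "a = b"
proof (rule digits_inj[OF assms(1,2)])
  fix i assume "i < e"
  then show "a div N ^ i mod N = b div N ^ i mod N"
    using assms(3)[of "2 * N\<^sup>2 + i"] by (simp add: pair_sub_def)
qed

text \<open>The bound on \<open>N (Suc k)\<close> says that \<open>e k\<close> digits tell the
  letters of level \<open>k + 1\<close> apart. The listing starts with the pair (0, 0), which gives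
  \<open>sub_first\<close>; the final 0 gives \<open>sub_last\<close>.\<close>

lemma substitution_sequence_pair_sub:
  assumes "\<And>k. 0 < N k" "\<And>k. N (Suc k) \<le> N k ^ e k"
  shows "substitution_sequence N (\<lambda>k. 2 * (N k)\<^sup>2 + e k + 1) (\<lambda>k. pair_sub (N k) (e k))"
proof
  fix k a b b' j
  show "2 \<le> 2 * (N k)\<^sup>2 + e k + 1" using assms(1)[of k]
    by (simp add: trans_le_add1 Suc_le_eq power2_eq_square)
  show "0 < N k" by fact
  show "pair_sub (N k) (e k) a j < N k" by (rule pair_sub_less) fact
  show "pair_sub (N k) (e k) 0 0 = 0" by (simp add: pair_sub_def)
  show "pair_sub (N k) (e k) 0 (2 * (N k)\<^sup>2 + e k + 1 - 1) = 0" by (simp add: pair_sub_def)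
  show "\<exists>j. Suc j < 2 * (N k)\<^sup>2 + e k + 1 \<and> pair_sub (N k) (e k) a j = b \<and> pair_sub (N k) (e k) a (Suc j) = b'"
    if "b < N k" "b' < N k" using that by (rule pair_sub_pairs)
  show "a = b" if "a < N (Suc k)" "b < N (Suc k)"
    "\<And>j. j < 2 * (N k)\<^sup>2 + e k + 1 \<Longrightarrow> pair_sub (N k) (e k) a j = pair_sub (N k) (e k) b j"
    using that assms(2)[of k] by (intro pair_sub_inj[of a "N k" "e k" b]) auto
qed

section \<open>The growth of the block lengths\<close>

text \<open>The summand 1 keeps the width positive even for \<open>l = 1\<close>.\<close>

definition width :: "real \<Rightarrow> nat \<Rightarrow> nat" where
  "width r l = nat \<lceil>ln (real l) powr r\<rceil> + 1"

text \<open>The block lengths at even levels. The factors are the image lengths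
  \<open>2 * N\<^sup>2 + e + 1\<close> for \<open>N = 2\<close>, \<open>e = w\<close> and then for
  \<open>N = 2 ^ w\<close>, \<open>e = 1\<close>.\<close>

primrec len :: "real \<Rightarrow> nat \<Rightarrow> nat" where
  "len r 0 = 1"
| "len r (Suc j) = len r j * (width r (len r j) + 9) * (2 * 4 ^ width r (len r j) + 2)"

declare len.simps(2) [simp del]

lemma width_ge: "ln (real l) powr r \<le> real (width r l)"
  unfolding width_def by linarith

lemma width_le: "real (width r l) \<le> ln (real l) powr r + 2"
proof -
  have "0 \<le> ln (real l) powr r" by simp
  then show ?thesis unfolding width_def by linarith
qed

lemma len_Suc_ge: "2 * len r j \<le> len r (Suc j)" "20 \<le> len r (Suc j)" "1 \<le> len r j"
proof -
  show pos: "1 \<le> len r j"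
  proof (induction j)
    case (Suc j)
    then show ?case by (simp add: len.simps(2) Suc_le_eq)
  qed simp
  let ?w = "width r (len r j)"
  have "10 * 2 \<le> (?w + 9) * (2 * 4 ^ ?w + 2)" by (rule mult_mono) (auto simp: width_def)
  then have "len r j * 20 \<le> len r (Suc j)" by (simp only: len.simps mult.assoc mult_le_mono)
  then show "2 * len r j \<le> len r (Suc j)" "20 \<le> len r (Suc j)" using pos by linarith+
qed

lemma one_le_ln_len_Suc: "1 \<le> ln (real (len r (Suc j)))"
proof -
  have "exp 1 \<le> (3::real)" by (rule exp_le)
  also have "\<dots> \<le> real (len r (Suc j))" using len_Suc_ge(2)[of r j] by linarith
  finally have "exp 1 \<le> real (len r (Suc j))" .
  moreover have "0 < real (len r (Suc j))" using len_Suc_ge(2)[of r j] by linarith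
  ultimately show ?thesis by (simp only: ln_ge_iff)
qed

text \<open>The width is of order \<open>ln l\<close> to the power \<open>r\<close>, so its
  logarithm is at most a multiple of \<open>ln l\<close>.\<close>

lemma ln_len_mult_width_le:
  assumes "1 \<le> ln (real l)" "1 \<le> r"
  shows "ln (real (l * (width r l + 9))) \<le> (13 + r) * ln (real l)"
proof -
  define y where "y = ln (real l)"
  have y: "1 \<le> y" using assms by (simp add: y_def)
  have l: "0 < l" using assms(1) by (cases l) auto
  have one: "1 \<le> y powr r" using y assms(2) by (simp add: ge_one_powr_ge_zero)
  \<comment> \<open>The constant is 1 + 2 + 9, using that \<open>y powr r\<close> is at least
    1.\<close>
  have "real (width r l) + 9 \<le> 12 * y powr r" using width_le[of r l] one by (simp add: y_def)
  then have "ln (real (width r l) + 9) \<le> ln (12 * y powr r)" by (subst ln_le_cancel_iff) (use one in auto)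
  also have "\<dots> = ln 12 + r * ln y" using y by (simp add: ln_mult ln_powr)
  also have "\<dots> \<le> 12 * y + r * y"
    using y assms(2) ln_bound[of y] ln_bound[of 12] by (intro add_mono mult_left_mono) auto
  finally have "ln (real (width r l) + 9) \<le> 12 * y + r * y" .
  moreover have "ln (real (l * (width r l + 9))) = y + ln (real (width r l) + 9)"
    using l unfolding y_def of_nat_mult by (subst ln_mult_pos) auto
  ultimately show ?thesis by (simp add: y_def algebra_simps)
qed

text \<open>The dominant factor of \<open>len r (Suc j)\<close> is \<open>4 ^ w\<close>, whose
  logarithm is linear in \<open>w\<close>, hence of order \<open>y powr r\<close>.\<close>

lemma ln_len_Suc_le:
  fixes y :: real
  assumes "1 \<le> r" "ln 2 \<le> y" "ln (real (len r j)) \<le> y"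
  shows "ln (2 * real (len r (Suc j))) \<le> (21 * (1 / ln 2) powr r + 3) * y powr r"
proof -
  define l w where "l = len r j" and "w = width r l"
  \<comment> \<open>Since \<open>y\<close> may be below 1, \<open>y powr r\<close> need not absorb
    constants; \<open>D\<close>, the power of \<open>y / ln 2\<close>, is at least 1 and at least
    \<open>y\<close>.\<close>
  define D where "D = (1 / ln 2 :: real) powr r * y powr r"
  have ln2: "0 < ln (2::real)" "ln (2::real) \<le> 1" using ln_2_less_1 by auto
  have l: "1 \<le> l" using len_Suc_ge(3) by (simp add: l_def)
  have w: "real w \<le> y powr r + 2"
  proof -
    have "ln (real l) powr r \<le> y powr r" using assms l by (intro powr_mono2) (auto simp: l_def)
    then show ?thesis using width_le[of r l] by (simp add: w_def)
  qed
  have D: "D = (y / ln 2) powr r"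
    unfolding D_def using assms(2) ln2 by (simp add: powr_mult[symmetric])
  have ratio: "1 \<le> y / ln 2" using assms(2) ln2 by simp
  then have "(y / ln 2) powr 1 \<le> D" unfolding D using assms(1) by (intro powr_mono)
  then have "y / ln 2 \<le> D" using ratio by (simp only: powr_one')
  moreover have "y \<le> y / ln 2"
  proof -
    have "0 \<le> y" using ln2 assms(2) by linarith
    then show ?thesis
      using ln2 mult_left_mono[of "ln 2" 1 y] by (simp add: pos_le_divide_eq)
  qed
  ultimately have one: "1 \<le> D" and yD: "y \<le> D" using ratio by linarith+
  have w1: "ln (real w + 9) \<le> real w + 8" using ln_add_one_self_le_self[of "real w + 8"] by (simp add: add_ac)
  have "2 * 4 ^ w + 2 \<le> (4::real) ^ (w + 1)" using one_le_power[of "4::real" w] by simp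
  then have "ln (2 * 4 ^ w + 2 :: real) \<le> ln (4 ^ (w + 1))" by (subst ln_le_cancel_iff) (auto simp: add_pos_pos)
  also have "\<dots> = (real w + 1) * ln 4" by (simp only: ln_realpow zero_less_numeral) simp
  also have "\<dots> \<le> (real w + 1) * 2"
    using ln2 ln_realpow[of 2 2] by (intro mult_left_mono) auto
  finally have w2: "ln (2 * 4 ^ w + 2 :: real) \<le> 2 * real w + 2" by simp
  have pos: "0 < 2 * (4::real) ^ w + 2" by (simp add: add_pos_pos)
  have "2 * real (len r (Suc j)) = 2 * (real l * ((real w + 9) * (2 * 4 ^ w + 2)))"
    by (simp only: len.simps(2) l_def w_def of_nat_mult of_nat_add of_nat_power of_nat_numeral mult.assoc)
  also have "ln \<dots> = ln 2 + (ln (real l) + (ln (real w + 9) + ln (2 * 4 ^ w + 2)))"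
    using l pos by (subst ln_mult_pos, simp, simp)+ simp
  also have "\<dots> \<le> 1 + (y + (real w + 8 + (2 * real w + 2)))"
    using ln2 w1 w2 assms(3) by (intro add_mono) (auto simp: l_def)
  also have "\<dots> \<le> 17 + y + 3 * y powr r" using w by simp
  also have "\<dots> \<le> 21 * D + 3 * y powr r" using one yD by linarith
  finally show ?thesis by (simp add: D_def algebra_simps)
qed

theorem theorem1p7:
  fixes r :: real
  assumes "2 \<le> r"
  shows "\<exists>(A :: nat set) (X :: (int \<Rightarrow> nat) set) (C :: real) (c :: real) (n :: nat \<Rightarrow> nat).
           minimal_subshift A X \<and> C > 0 \<and> c > 0 \<and>
           strict_mono n \<and> (\<forall>i. n i > 0) \<and>
           (\<forall>m\<ge>2. real (subshift_recurrence X m) \<le> exp (C * ln (real m) powr r)) \<and>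
           (\<forall>i. real (subshift_complexity X (n i)) \<ge> exp (c * ln (real (n i)) powr r))"
proof -
  have r: "1 \<le> r" using assms by simp
  define w where "w j = width r (len r j)" for j
  define N :: "nat \<Rightarrow> nat" where "N k = (if even k then 2 else 2 ^ w (k div 2))" for k
  \<comment> \<open>\<open>w\<close> binary digits distinguish \<open>2 ^ w\<close> letters; one
    digit in base \<open>2 ^ w\<close> distinguishes two.\<close>
  define e where "e k = (if even k then w (k div 2) else 1)" for k
  define M where "M k = 2 * (N k)\<^sup>2 + e k + 1" for k
  have N_pos: "0 < N k" for k by (simp add: N_def)
  have w_ge: "1 \<le> w j" for j by (simp add: w_def width_def)
  have N_Suc: "N (Suc k) \<le> N k ^ e k" for k
    using self_le_power[of 2 "w (k div 2)"] w_ge[of "k div 2"] by (auto simp: N_def e_def)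
  interpret substitution_sequence N M "\<lambda>k. pair_sub (N k) (e k)"
    unfolding M_def using N_pos N_Suc by (rule substitution_sequence_pair_sub)
  have L_even: "L (2 * j) = len r j" for j
  proof (induction j)
    case (Suc j)
    have "L (2 * Suc j) = M (Suc (2 * j)) * (M (2 * j) * L (2 * j))" by (simp add: L_Suc)
    also have "M (2 * j) = w j + 9" by (simp add: M_def N_def e_def)
    also have "M (Suc (2 * j)) = 2 * 4 ^ w j + 2"
      by (simp add: M_def N_def e_def power2_eq_square power_mult_distrib[symmetric])
    finally show ?case unfolding Suc by (simp only: w_def mult_ac len.simps)
  qed simp
  have L_odd: "L (Suc (2 * j)) = len r j * (width r (len r j) + 9)" for j
    using L_even[of j] by (simp add: L_Suc M_def N_def e_def w_def mult_ac)
  have ln_odd: "ln (real (L (Suc (2 * Suc j)))) \<le> (13 + r) * ln (real (len r (Suc j)))" for j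
    unfolding L_odd by (rule ln_len_mult_width_le[OF one_le_ln_len_Suc r])
  \<comment> \<open>The odd levels are those with \<open>2 ^ w\<close> blocks. Level 1 is skipped
    because \<open>ln (len r 0) = 0\<close>, while the estimates need a logarithm of at least
    1.\<close>
  define n where "n i = L (Suc (2 * Suc i))" for i
  \<comment> \<open>\<open>ln 2\<close> comes from writing \<open>2 ^ w\<close> as an exponential,
    the denominator from \<open>ln_odd\<close>.\<close>
  define c where "c = ln 2 / (13 + r) powr r"
  define C1 where "C1 = 21 * (1 / ln 2) powr r + (3 :: real)"
  define C where "C = (15 + r) * C1"
  have C1: "0 < C1" by (simp add: C1_def add_nonneg_pos)
  have complexity: "exp (c * ln (real (n i)) powr r) \<le> real (complexity word (n i))" for i
  proof -
    let ?y = "ln (real (len r (Suc i)))"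
    have y: "1 \<le> ?y" by (rule one_le_ln_len_Suc)
    have "1 \<le> real (n i)" using L_pos[of "Suc (2 * Suc i)"] unfolding n_def by linarith
    then have "ln (real (n i)) powr r \<le> ((13 + r) * ?y) powr r"
      using ln_odd[of i] r by (intro powr_mono2) (auto simp: n_def)
    also have "\<dots> = (13 + r) powr r * ?y powr r" using r y by (simp add: powr_mult)
    finally have "c * ln (real (n i)) powr r \<le> c * ((13 + r) powr r * ?y powr r)"
      using r by (intro mult_left_mono) (auto simp: c_def)
    also have "\<dots> = ln 2 * ?y powr r" using r by (simp add: c_def)
    also have "\<dots> \<le> ln 2 * real (w (Suc i))" using width_ge by (intro mult_left_mono) (auto simp: w_def)
    finally have "exp (c * ln (real (n i)) powr r) \<le> exp (ln 2 * real (w (Suc i)))" by simp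
    also have "\<dots> = 2 ^ w (Suc i)" by (simp add: exp_of_nat2_mult)
    also have "\<dots> = real (N (Suc (2 * Suc i)))" by (simp add: N_def)
    also have "\<dots> \<le> real (complexity word (n i))"
      unfolding n_def using complexity_word_ge by (simp only: of_nat_le_iff)
    finally show ?thesis .
  qed
  have recurrence: "real (recurrence word m) \<le> exp (C * ln (real m) powr r)" if m: "2 \<le> m" for m
  proof -
    let ?y = "ln (real m)"
    have y: "ln 2 \<le> ?y" using m by simp
    have "\<exists>k. m \<le> L k" by (rule exI, rule strict_mono_imp_increasing[OF strict_mono_L])
    define k where "k = (LEAST k. m \<le> L k)"
    have k: "m \<le> L k" unfolding k_def by (rule LeastI_ex) fact
    then obtain k' where k': "k = Suc k'" using m by (cases k) auto
    then have "k' < (LEAST k. m \<le> L k)" unfolding k_def by linarith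
    from not_less_Least[OF this] have "L k' < m" by simp
    \<comment> \<open>For either parity of \<open>k'\<close>, \<open>2 * j \<le> k'\<close> and
      \<open>k' + 2 \<le> 2 * j + 3\<close>: thus \<open>len r j < m\<close>, and
      \<open>L (Suc k)\<close> is at most the odd-level length after
      \<open>len r (Suc j)\<close>.\<close>
    define j where "j = k' div 2"
    have "len r j \<le> L k'"
      unfolding L_even[symmetric] strict_mono_less_eq[OF strict_mono_L] by (simp add: j_def)
    with \<open>L k' < m\<close> have "len r j < m" by simp
    then have "ln (real (len r j)) \<le> ?y" using len_Suc_ge(3)[of r j] by (subst ln_le_cancel_iff) auto
    from ln_len_Suc_le[OF r y this] have B: "ln (2 * real (len r (Suc j))) \<le> C1 * ?y powr r"
      by (simp add: C1_def)
    let ?z = "ln (real (len r (Suc j)))"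
    have z: "1 \<le> ?z" by (rule one_le_ln_len_Suc)
    have lz: "ln (2 * real (len r (Suc j))) = ln 2 + ?z"
      using len_Suc_ge(2)[of r j] by (subst ln_mult_pos) auto
    have ln2: "0 < ln (2::real)" "ln (2::real) \<le> 1" using ln_2_less_1 by auto
    from B lz ln2(1) have B': "?z \<le> C1 * ?y powr r" by linarith
    have "L (Suc k) \<le> L (Suc (2 * Suc j))"
      unfolding strict_mono_less_eq[OF strict_mono_L] by (simp add: k' j_def)
    then have "ln (real (L (Suc k))) \<le> ln (real (L (Suc (2 * Suc j))))"
      using L_pos by (subst ln_le_cancel_iff) auto
    then have "ln (2 * real (L (Suc k))) \<le> ln 2 + (13 + r) * ?z"
      using ln_odd[of j] L_pos[of "Suc k"] by (subst ln_mult_pos) auto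
    also have "\<dots> \<le> (15 + r) * ?z" using ln2 z by (simp add: algebra_simps)
    also have "\<dots> \<le> (15 + r) * (C1 * ?y powr r)"
      using B' r by (intro mult_left_mono) auto
    finally have "exp (ln (2 * real (L (Suc k)))) \<le> exp (C * ?y powr r)"
      by (simp only: exp_le_cancel_iff C_def mult.assoc)
    then have "2 * real (L (Suc k)) \<le> exp (C * ?y powr r)"
      using L_pos[of "Suc k"] by simp
    moreover have "real (recurrence word m) \<le> 2 * real (L (Suc k))"
      using recurrence_word_le[OF k] by (simp flip: of_nat_le_iff[where ?'a = real])
    ultimately show ?thesis by linarith
  qed
  have unbounded: "\<exists>k. p < N k" for p
  proof -
    have len: "2 ^ j \<le> len r j" for j
    proof (induction j)
      case (Suc j)
      then show ?case using len_Suc_ge(1)[of r j] by simp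
    qed simp
    \<comment> \<open>Large enough that \<open>?j * (2 / 3)\<close> exceeds \<open>p\<close>, where
      2/3 is a lower bound for \<open>ln 2\<close>.\<close>
    let ?j = "Suc (2 * p)"
    have "2 ^ ?j \<le> real (len r ?j)"
      using len[of ?j] by (simp only: of_nat_le_iff[where ?'a = real, symmetric] of_nat_power of_nat_numeral)
    then have "ln (2 ^ ?j) \<le> ln (real (len r ?j))"
      by (subst ln_le_cancel_iff) (use len_Suc_ge(3)[of r ?j] in auto)
    then have "real ?j * ln 2 \<le> ln (real (len r ?j))" by (simp only: ln_realpow)
    moreover have "real ?j * (2 / 3) \<le> real ?j * ln 2"
      using ln2_ge_two_thirds by (intro mult_left_mono) auto
    moreover have "ln (real (len r ?j)) \<le> ln (real (len r ?j)) powr r"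
      using powr_mono[OF r one_le_ln_len_Suc[of r "2 * p"]] one_le_ln_len_Suc[of r "2 * p"] by simp
    moreover have "\<dots> \<le> real (w ?j)" unfolding w_def by (rule width_ge)
    ultimately have "p < w ?j" by simp
    also have "\<dots> < N (Suc (2 * ?j))" by (simp add: N_def)
    finally show ?thesis by blast
  qed
  define X where "X = full_shift {..<N 0} closure_of range (\<lambda>i. shift_pow i word)"
  have X: "minimal_subshift {..<N 0} X" "word \<in> X"
    using minimal_subshift_word[OF _ unbounded] by (auto simp: X_def N_def)
  have "strict_mono n"
    unfolding n_def by (intro strict_monoI strict_monoD[OF strict_mono_L]) simp
  moreover have "0 < C" "0 < c" using C1 r by (auto simp: C_def c_def)
  moreover have "0 < n i" for i using L_pos by (simp add: n_def)
  moreover note X(1) complexity[folded minimal_subshift_complexity[OF X]]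
    recurrence[folded minimal_subshift_recurrence[OF X]]
  ultimately show ?thesis
    by (intro exI[of _ "{..<N 0}"] exI[of _ X] exI[of _ C] exI[of _ c] exI[of _ n] conjI allI impI)
qed

end
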